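(* Let $K\subseteq\{0,1\}^n$ be a totally-ordered multiple knapsack set and let $\alpha^Tx\le\beta$ be a multi-cover inequality (MCI) generated from a multi-cover $\{C_1,\ldots,C_k\}$ for $K$, with $C=\bigcup_{h=1}^kC_h$. Then the extended MCI $$\sum_{i\in[n]\setminus C}\Big(\max_{h\in[k]:\,i<\min(C_h)}\alpha_{2,C_h}\Big)x_i+\alpha^Tx\le\beta$$ is valid for $K$, where a maximum over an empty set is $0$.
   Context: Notation: $[n]=\{1,\ldots,n\}$; for a vector $\alpha\in\mathbb{R}^n$ and $S\subseteq[n]$, $\alpha(S)=\sum_{i\in S}\alpha_i$; $\chi^S$ is the incidence vector of $S$; $\min(S)$ is the least element of $S$. For a set $C_h$, $\alpha_{2,C_h}$ denotes the second least number in the multiset $\{\alpha_i : i\in C_h\}$, which allows duplication (so if the minimum is attained more than once, then $\alpha_{2,C_h}=\min_{i\in C_h}\alpha_i$). Totally-ordered multiple knapsack set (TOMKS): a set $K=\{x\in\{0,1\}^n\mid Ax\le b\}$ where $A\in\mathbb{Z}_+^{m\times n}$, $b\in\mathbb{Z}_+^m$ (nonnegative integer entries), and the columns of $A$ form a chain in the componentwise order, indexed so that $A_{\cdot1}\ge A_{\cdot2}\ge\cdots\ge A_{\cdot n}$. A set $S\subseteq[n]$ is a cover for $K$ if $\chi^S\notin K$. Dominance: for $S_1,S_2\subseteq[n]$, $S_1$ dominates $S_2$ (written $S_1\triangleright S_2$) if there is an injective function $f:S_2\to S_1$ with $f(i)\le i$ for all $i\in S_2$. Given a family $\mathscr{C}=\{C_1,\ldots,C_k\}$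 of covers for $K$, let $C_0=\bigcap_{h=1}^kC_h$, $C=\bigcup_{h=1}^kC_h$, $\bar C_h=C\setminus C_h$. The discrepancy family is $\mathcal{D}(\mathscr{C})=\{C_1\setminus C_0,\ldots,C_k\setminus C_0\}$. The family $\mathscr{C}$ is a multi-cover for $K$ if for every $T\subseteq\bigcup_{D\in\mathcal{D}(\mathscr{C})}D$ with $T\notin\mathcal{D}(\mathscr{C})$ there is $D'\in\mathcal{D}(\mathscr{C})$ with $T\triangleright D'$ or $D'\triangleright T$. Multi-cover inequality (MCI): given a multi-cover $\{C_1,\ldots,C_k\}$, write $C\setminus C_0=\{i_1<\cdots<i_r\}$. An MCI associated with (generated from) the multi-cover is any inequality $\alpha^Tx\le\beta$ produced as follows (a maximum or minimum over an empty set is taken to be $0$): $\alpha_i=0$ for $i\notin C$; $\alpha_{i_r}=1$; successively for $t=r-1,\ldots,1$, $\alpha_{i_t}$ is any integer with $$\alpha_{i_t}\ge \Big(\max_{h\in[k]:\,i_t\in C_h}\ \max_{\ell\in\bar C_h:\,\ell>i_t}\alpha_\ell\Big)+1;$$ then for each $j\in C_0$, $\alpha_j$ is any integer with $$\alpha_j\ge\min_{h\in[k]}\max\Big\{\max_{\ell<j,\ \ell\in\bar C_h}\alpha_\ell,\ \sum_{\ell>j,\ \ell\in\bar C_h}\alpha_\ell+1\Big\};$$ finally $\beta=\max_{h\in[k]}\alpha(C_h)-1$. *)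

theory Defs
  imports Main "HOL-Library.Multiset" "HOL-Library.Indicator_Function"
begin

text \<open>
  Index sets are \<open>{1..n}\<close>. A vector of length \<open>n\<close> is a function \<open>nat \<Rightarrow> int\<close>; points of
  \<open>{0,1}\<^sup>n\<close> are required to vanish outside \<open>{1..n}\<close>, so that each is represented by exactly
  one function and the incidence vector of \<open>S \<subseteq> {1..n}\<close> is \<open>indicator S\<close>.
\<close>

definition knapsack_set ::
    "nat \<Rightarrow> nat \<Rightarrow> (nat \<Rightarrow> nat \<Rightarrow> int) \<Rightarrow> (nat \<Rightarrow> int) \<Rightarrow> (nat \<Rightarrow> int) set" where
  "knapsack_set m n A b =
     {x. (\<forall>i\<in>{1..n}. x i \<in> {0, 1}) \<and> (\<forall>i. i \<notin> {1..n} \<longrightarrow> x i = 0) \<and>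
         (\<forall>p\<in>{1..m}. (\<Sum>i\<in>{1..n}. A p i * x i) \<le> b p)}"

definition is_TOMKS :: "nat \<Rightarrow> (nat \<Rightarrow> int) set \<Rightarrow> bool" where
  "is_TOMKS n K \<longleftrightarrow>
     (\<exists>m A b.
        (\<forall>p\<in>{1..m}. \<forall>i\<in>{1..n}. 0 \<le> A p i) \<and>
        (\<forall>p\<in>{1..m}. 0 \<le> b p) \<and>
        (\<forall>i\<in>{1..n}. \<forall>j\<in>{1..n}. i \<le> j \<longrightarrow> (\<forall>p\<in>{1..m}. A p j \<le> A p i)) \<and>
        K = knapsack_set m n A b)"

definition is_cover :: "nat \<Rightarrow> (nat \<Rightarrow> int) set \<Rightarrow> nat set \<Rightarrow> bool" where
  "is_cover n K S \<longleftrightarrow> S \<subseteq> {1..n} \<and> indicator S \<notin> K"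

definition dominates :: "nat set \<Rightarrow> nat set \<Rightarrow> bool" (infix "\<triangleright>" 50) where
  "S1 \<triangleright> S2 \<longleftrightarrow> (\<exists>f. inj_on f S2 \<and> f ` S2 \<subseteq> S1 \<and> (\<forall>i\<in>S2. f i \<le> i))"

text \<open>A family \<open>C\<^sub>1, \<dots>, C\<^sub>k\<close> is given by \<open>k\<close> and a function \<open>Cs\<close>, of which only the values on
  \<open>{1..k}\<close> matter.\<close>

definition family_inter :: "nat \<Rightarrow> (nat \<Rightarrow> nat set) \<Rightarrow> nat set" where
  "family_inter k Cs = (\<Inter>h\<in>{1..k}. Cs h)"

definition family_union :: "nat \<Rightarrow> (nat \<Rightarrow> nat set) \<Rightarrow> nat set" where
  "family_union k Cs = (\<Union>h\<in>{1..k}. Cs h)"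

definition co_member :: "nat \<Rightarrow> (nat \<Rightarrow> nat set) \<Rightarrow> nat \<Rightarrow> nat set" where
  "co_member k Cs h = family_union k Cs - Cs h"

definition discrepancy_family :: "nat \<Rightarrow> (nat \<Rightarrow> nat set) \<Rightarrow> nat set set" where
  "discrepancy_family k Cs = (\<lambda>h. Cs h - family_inter k Cs) ` {1..k}"

definition is_multi_cover ::
    "nat \<Rightarrow> (nat \<Rightarrow> int) set \<Rightarrow> nat \<Rightarrow> (nat \<Rightarrow> nat set) \<Rightarrow> bool" where
  "is_multi_cover n K k Cs \<longleftrightarrow>
     1 \<le> k \<and> (\<forall>h\<in>{1..k}. is_cover n K (Cs h)) \<and>
     (\<forall>T. T \<subseteq> \<Union>(discrepancy_family k Cs) \<and> T \<notin> discrepancy_family k Cs \<longrightarrow>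
        (\<exists>D'\<in>discrepancy_family k Cs. T \<triangleright> D' \<or> D' \<triangleright> T))"

definition max0 :: "int set \<Rightarrow> int" where
  "max0 X = (if X = {} then 0 else Max X)"

text \<open>The sequential choice of the coefficients is expressed as one condition on the resulting
  vector \<open>\<alpha>\<close>: the bound for an index in \<open>C - C\<^sub>0\<close> only involves coefficients of larger indices
  in \<open>C - C\<^sub>0\<close>, and the bound for an index in \<open>C\<^sub>0\<close> only coefficients of indices in \<open>C - C\<^sub>0\<close>.
  The outer minimum and the maximum defining \<open>\<beta>\<close> range over the nonempty set \<open>{1..k}\<close>.\<close>

definition is_MCI ::
    "nat \<Rightarrow> (nat \<Rightarrow> nat set) \<Rightarrow> (nat \<Rightarrow> int) \<Rightarrow> int \<Rightarrow> bool" where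
  "is_MCI k Cs \<alpha> \<beta> \<longleftrightarrow>
     (let C = family_union k Cs; C0 = family_inter k Cs; Cbar = co_member k Cs in
       (\<forall>i. i \<notin> C \<longrightarrow> \<alpha> i = 0) \<and>
       (C - C0 \<noteq> {} \<longrightarrow> \<alpha> (Max (C - C0)) = 1) \<and>
       (\<forall>i\<in>C - C0. i \<noteq> Max (C - C0) \<longrightarrow>
          \<alpha> i \<ge> max0 {max0 (\<alpha> ` {l \<in> Cbar h. l > i}) | h. h \<in> {1..k} \<and> i \<in> Cs h} + 1) \<and>
       (\<forall>j\<in>C0.
          \<alpha> j \<ge> Min {max (max0 (\<alpha> ` {l \<in> Cbar h. l < j}))
                          ((\<Sum>l\<in>{l \<in> Cbar h. l > j}. \<alpha> l) + 1) | h. h \<in> {1..k}}) \<and>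
       \<beta> = Max {\<Sum>i\<in>Cs h. \<alpha> i | h. h \<in> {1..k}} - 1)"

text \<open>The second least element of the multiset of the values of \<open>\<alpha>\<close> on \<open>S\<close>, i.e. the minimum
  after removing one copy of the least value. For \<open>card S = 1\<close> nothing remains and the value is
  \<open>0\<close>, the convention for a minimum over the empty set.\<close>

definition second_least :: "(nat \<Rightarrow> int) \<Rightarrow> nat set \<Rightarrow> int" where
  "second_least \<alpha> S =
     (let xs = sorted_list_of_multiset (image_mset \<alpha> (mset_set S))
      in if 2 \<le> length xs then xs ! 1 else 0)"

definition extended_coeff ::
    "nat \<Rightarrow> (nat \<Rightarrow> nat set) \<Rightarrow> (nat \<Rightarrow> int) \<Rightarrow> nat \<Rightarrow> int" where
  "extended_coeff k Cs \<alpha> i =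
     max0 {second_least \<alpha> (Cs h) | h. h \<in> {1..k} \<and> i < Min (Cs h)}"

end

theory Submission
  imports Defs
begin

text \<open>
  The support \<open>X\<close> of a point of \<open>K\<close> dominates no cover, and this property is inherited by every
  set that \<open>X\<close> dominates. So \<open>X\<close> is replaced step by step by dominated sets without decreasing its
  weight. An element \<open>i \<in> X - C\<close> with positive coefficient, attained at \<open>h\<close>, is exchanged for an
  element of \<open>C\<^sub>h - X\<close> whose coefficient is at least \<open>\<alpha>\<^bsub>2,C\<^sub>h\<^esub>\<close>: if there were none, \<open>X\<close> would miss at
  most one element of \<open>C\<^sub>h\<close>, which \<open>i\<close> could replace, and \<open>X\<close> would dominate \<open>C\<^sub>h\<close>.
  Once \<open>X \<subseteq> C\<close>, an element \<open>j \<in> C\<^sub>0 - X\<close>, with \<open>h\<close> attaining the minimum in the bound for \<open>\<alpha>\<^sub>j\<close>,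
  is exchanged for some \<open>l < j\<close> in \<open>X - C\<^sub>h\<close>; if there is no such \<open>l\<close>, then \<open>X - C\<^sub>h\<close> lies above
  \<open>j\<close> and weighs less than \<open>j\<close> alone, so \<open>\<alpha>(X) < \<alpha>(C\<^sub>h)\<close>. Once \<open>C\<^sub>0 \<subseteq> X \<subseteq> C\<close>, the multi-cover
  property yields a \<open>C\<^sub>h\<close> that dominates \<open>X\<close>, and then \<open>\<alpha>(X) < \<alpha>(C\<^sub>h)\<close>.
\<close>

section \<open>Dominance\<close>

lemma dominates_trans:
  assumes "X \<triangleright> Y" and "Y \<triangleright> Z"
  shows "X \<triangleright> Z"
proof -
  obtain f where f: "inj_on f Y" "f ` Y \<subseteq> X" "\<forall>i\<in>Y. f i \<le> i"
    using assms(1) unfolding dominates_def by blast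
  obtain g where g: "inj_on g Z" "g ` Z \<subseteq> Y" "\<forall>i\<in>Z. g i \<le> i"
    using assms(2) unfolding dominates_def by blast
  have "inj_on (f \<circ> g) Z"
    using f(1) g(1,2) by (meson comp_inj_on inj_on_subset)
  moreover have "(f \<circ> g) ` Z \<subseteq> X"
    using f(2) g(2) by auto
  moreover have "\<forall>i\<in>Z. (f \<circ> g) i \<le> i"
    using f(3) g(2,3) by (metis comp_apply image_subset_iff le_trans)
  ultimately show ?thesis
    unfolding dominates_def by blast
qed

lemma dominates_subset: "Y \<subseteq> X \<Longrightarrow> X \<triangleright> Y"
  unfolding dominates_def by (rule exI[of _ id]) auto

lemma dominates_exchange:
  assumes "i \<in> X" and "i \<le> m"
  shows "X \<triangleright> insert m (X - {i})"
  unfolding dominates_def using assms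
  by (intro exI[of _ "\<lambda>z. if z = m then i else z"]) (auto simp: inj_on_def)

text \<open>The injection is extended by the identity on \<open>Z\<close>. Its values on
  \<open>Y - Z\<close> lie in \<open>X\<close>, hence outside \<open>Z\<close>, so nothing collides
  even if \<open>Y\<close> meets \<open>Z\<close>.\<close>

lemma dominates_Un:
  assumes "X \<triangleright> Y" and "X \<inter> Z = {}"
  shows "Z \<union> X \<triangleright> Z \<union> Y"
proof -
  obtain f where f: "inj_on f Y" "f ` Y \<subseteq> X" "\<forall>i\<in>Y. f i \<le> i"
    using assms(1) unfolding dominates_def by blast
  have "inj_on (\<lambda>z. if z \<in> Z then z else f z) (Z \<union> Y)"
    using f(1,2) assms(2) unfolding inj_on_def
    by (smt (verit) Un_iff disjoint_iff image_subset_iff)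
  then show ?thesis
    unfolding dominates_def using f(2,3)
    by (intro exI[of _ "\<lambda>z. if z \<in> Z then z else f z"]) auto
qed

lemma dominates_remove:
  assumes "D \<triangleright> T" and "a \<in> T"
  shows "D - {a} \<triangleright> T - {a}"
proof -
  obtain f where f: "inj_on f T" "f ` T \<subseteq> D" "\<forall>i\<in>T. f i \<le> i"
    using assms(1) unfolding dominates_def by blast
  \<comment> \<open>If some z \<noteq> a is mapped to \<open>a\<close>, it is rerouted to
    \<open>f a\<close>, a value freed by removing \<open>a\<close> from \<open>T\<close>; moreover f
    a \<le> a = f z \<le> z.\<close>
  define g where "g z = (if f z = a then f a else f z)" for z
  have "inj_on g (T - {a})"
    using f(1) assms(2) unfolding g_def inj_on_def by (smt (verit) Diff_iff insertCI)
  moreover have "g ` (T - {a}) \<subseteq> D - {a}"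
    using f(1,2) assms(2) unfolding g_def inj_on_def by auto
  moreover have "\<forall>i\<in>T - {a}. g i \<le> i"
    using f(3) assms(2) unfolding g_def by (auto intro: le_trans)
  ultimately show ?thesis
    unfolding dominates_def by blast
qed

lemma dominates_Diff:
  assumes "finite A" and "D \<triangleright> T" and "A \<subseteq> T"
  shows "D - A \<triangleright> T - A"
  using assms
proof (induction A rule: finite_induct)
  case (insert a A)
  then have "D - A - {a} \<triangleright> T - A - {a}"
    by (intro dominates_remove) auto
  then show ?case
    by (metis Diff_insert)
qed simp

text \<open>After cancelling \<open>D \<inter> T\<close>, the injection maps \<open>T - D\<close>
  into \<open>D - T\<close>, hence to strictly smaller indices, where \<open>less\<close> gives
  strictly larger weights.\<close>

lemma dominates_sum_less:
  fixes \<alpha> :: "nat \<Rightarrow> int"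
  assumes "finite D" and "finite T" and "D \<triangleright> T" and "T \<noteq> D"
    and pos: "\<And>i. i \<in> D \<Longrightarrow> 0 < \<alpha> i"
    and less: "\<And>i l. i \<in> D \<Longrightarrow> l \<in> T - D \<Longrightarrow> i < l \<Longrightarrow> \<alpha> l < \<alpha> i"
  shows "sum \<alpha> T < sum \<alpha> D"
proof -
  have "D - D \<inter> T \<triangleright> T - D \<inter> T"
    using assms by (intro dominates_Diff) auto
  then have "D - T \<triangleright> T - D"
    by (simp add: Diff_Int)
  then obtain f where f: "inj_on f (T - D)" "f ` (T - D) \<subseteq> D - T" "\<forall>i\<in>T - D. f i \<le> i"
    unfolding dominates_def by blast
  have "sum \<alpha> (T - D) < sum \<alpha> (D - T)"
  proof (cases "T - D = {}")
    case True
    \<comment> \<open>With no terms to compare, strictness comes from T \<noteq> D and positive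
      weights.\<close>
    then have "D - T \<noteq> {}"
      using assms(4) by blast
    then have "0 < sum \<alpha> (D - T)"
      using assms(1) pos by (intro sum_pos) auto
    then show ?thesis
      by (simp only: True sum.empty)
  next
    case False
    have "\<alpha> t < \<alpha> (f t)" if "t \<in> T - D" for t
      using that f(2,3) less[of "f t" t] by (metis DiffD1 DiffD2 image_subset_iff le_neq_implies_less)
    then have "sum \<alpha> (T - D) < (\<Sum>t\<in>T - D. \<alpha> (f t))"
      using assms(2) False by (intro sum_strict_mono) auto
    also have "\<dots> = sum \<alpha> (f ` (T - D))"
      using f(1) by (simp add: sum.reindex)
    also have "\<dots> \<le> sum \<alpha> (D - T)"
      using f(2) assms(1) pos by (intro sum_mono2) (auto intro: less_imp_le)
    finally show ?thesis .
  qed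
  then show ?thesis
    using sum.Int_Diff[OF assms(1), of \<alpha> T] sum.Int_Diff[OF assms(2), of \<alpha> D]
    by (simp add: Int_commute)
qed

text \<open>Columns decrease with the index, so moving \<open>S\<close> along the injection only
  increases each row sum. The load of \<open>S\<close> is thus at most that of \<open>x\<close>,
  which would make \<open>S\<close> feasible.\<close>

lemma knapsack_support_not_dominates_cover:
  assumes "is_TOMKS n K" and "x \<in> K" and "is_cover n K S"
  shows "\<not> {i \<in> {1..n}. x i = 1} \<triangleright> S"
proof
  let ?X = "{i \<in> {1..n}. x i = 1}"
  assume "?X \<triangleright> S"
  then obtain f where f: "inj_on f S" "f ` S \<subseteq> ?X" "\<forall>i\<in>S. f i \<le> i"
    unfolding dominates_def by blast
  obtain m A b where A: "\<forall>p\<in>{1..m}. \<forall>i\<in>{1..n}. (0::int) \<le> A p i"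
    and mono: "\<forall>i\<in>{1..n}. \<forall>j\<in>{1..n}. i \<le> j \<longrightarrow> (\<forall>p\<in>{1..m}. A p j \<le> A p i)"
    and K: "K = knapsack_set m n A b"
    using assms(1) unfolding is_TOMKS_def by blast
  have S: "S \<subseteq> {1..n}" "indicator S \<notin> K"
    using assms(3) unfolding is_cover_def by auto
  have x01: "\<forall>i\<in>{1..n}. x i \<in> {0, 1}" and xle: "\<forall>p\<in>{1..m}. (\<Sum>i\<in>{1..n}. A p i * x i) \<le> b p"
    using assms(2) unfolding K knapsack_set_def by auto
  have "(\<Sum>i\<in>{1..n}. A p i * indicator S i) \<le> b p" if p: "p \<in> {1..m}" for p
  proof -
    have "(\<Sum>i\<in>{1..n}. A p i * indicator S i) = sum (A p) S"
      using S(1) by (simp add: indicator_def if_distrib sum.If_cases Int_absorb1 cong: if_cong)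
    also have "\<dots> \<le> (\<Sum>i\<in>S. A p (f i))"
      using S(1) f(2,3) mono p by (intro sum_mono) (auto simp: subset_iff)
    also have "\<dots> = sum (A p) (f ` S)"
      using f(1) by (simp add: sum.reindex)
    also have "\<dots> \<le> sum (A p) ?X"
      using f(2) A p by (intro sum_mono2) auto
    also have "\<dots> = (\<Sum>i\<in>?X. A p i * x i)"
      by (intro sum.cong) auto
    also have "\<dots> = (\<Sum>i\<in>{1..n}. A p i * x i)"
      using x01 by (intro sum.mono_neutral_left) auto
    finally show ?thesis
      using xle p by fastforce
  qed
  then have "indicator S \<in> K"
    using S(1) unfolding K knapsack_set_def by (auto simp: indicator_def)
  then show False
    using S(2) by simp
qed

text \<open>As b \<ge> 0, the zero vector lies in \<open>K\<close>.\<close>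

lemma cover_nonempty:
  assumes "is_TOMKS n K" and "is_cover n K S"
  shows "S \<noteq> {}"
  using assms unfolding is_TOMKS_def is_cover_def knapsack_set_def by auto

section \<open>Coefficients\<close>

lemma max0_upper: "finite X \<Longrightarrow> x \<in> X \<Longrightarrow> x \<le> max0 X"
  unfolding max0_def by auto

lemma max0_nonneg: "finite X \<Longrightarrow> (\<And>x. x \<in> X \<Longrightarrow> 0 \<le> x) \<Longrightarrow> 0 \<le> max0 X"
  unfolding max0_def by auto

lemma max0_posE:
  assumes "finite X" and "0 < max0 X"
  shows "max0 X \<in> X"
  using assms unfolding max0_def by (auto split: if_splits)

lemma second_least_le:
  assumes "finite S" and "S \<noteq> {}"
  obtains m where "m \<in> S" "\<And>i. i \<in> S \<Longrightarrow> i \<noteq> m \<Longrightarrow> second_least \<alpha> S \<le> \<alpha> i"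
proof -
  \<comment> \<open>Sorting indices instead of values records which index carries the least value,
    so that ties set aside exactly one index, \<open>ys ! 0\<close>. For a singleton the claim is
    vacuous and the default 0 is harmless.\<close>
  define ys where "ys = sort_key \<alpha> (sorted_list_of_set S)"
  have set: "set ys = S"
    using assms(1) by (simp add: ys_def)
  have "image_mset \<alpha> (mset_set S) = mset (map \<alpha> ys)"
    using assms(1) by (metis mset_map mset_sort mset_sorted_list_of_multiset sorted_list_of_mset_set ys_def)
  moreover have sorted: "sorted (map \<alpha> ys)"
    by (simp add: ys_def)
  ultimately have xs: "sorted_list_of_multiset (image_mset \<alpha> (mset_set S)) = map \<alpha> ys"
    by (simp add: sorted_sort_id del: mset_map)
  have "ys \<noteq> []"
    using set assms(2) by auto
  show ?thesis
  proof
    show "ys ! 0 \<in> S"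
      using set \<open>ys \<noteq> []\<close> by (metis length_greater_0_conv nth_mem)
    fix i assume i: "i \<in> S" "i \<noteq> ys ! 0"
    then obtain p where p: "p < length ys" "ys ! p = i"
      using set by (metis in_set_conv_nth)
    then have "1 \<le> p"
      using i(2) by (cases p) auto
    then have "map \<alpha> ys ! 1 \<le> map \<alpha> ys ! p"
      using sorted p(1) by (intro sorted_nth_mono) auto
    then show "second_least \<alpha> S \<le> \<alpha> i"
      using p \<open>1 \<le> p\<close> unfolding second_least_def xs by (auto simp: Let_def)
  qed
qed

section \<open>Validity\<close>

locale multi_cover_inequality =
  fixes n k :: nat and K :: "(nat \<Rightarrow> int) set" and Cs :: "nat \<Rightarrow> nat set"
    and \<alpha> :: "nat \<Rightarrow> int" and \<beta> :: int
  assumes TOMKS: "is_TOMKS n K"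
    and multi_cover: "is_multi_cover n K k Cs"
    and MCI: "is_MCI k Cs \<alpha> \<beta>"
begin

section \<open>The cover family and its index sets\<close>

abbreviation "C \<equiv> family_union k Cs"
abbreviation "C0 \<equiv> family_inter k Cs"

lemma cover: "h \<in> {1..k} \<Longrightarrow> is_cover n K (Cs h)"
  using multi_cover unfolding is_multi_cover_def by blast

lemma cover_subset: "h \<in> {1..k} \<Longrightarrow> Cs h \<subseteq> {1..n}"
  using cover unfolding is_cover_def by blast

lemma finite_cover: "h \<in> {1..k} \<Longrightarrow> finite (Cs h)"
  using cover_subset finite_subset by blast

lemma C_subset: "C \<subseteq> {1..n}"
  using cover_subset unfolding family_union_def by blast

lemma finite_C: "finite C"
  using C_subset finite_subset by blast

lemma cover_subset_C: "h \<in> {1..k} \<Longrightarrow> Cs h \<subseteq> C"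
  unfolding family_union_def by blast

lemma C0_subset_cover: "h \<in> {1..k} \<Longrightarrow> C0 \<subseteq> Cs h"
  unfolding family_inter_def by blast

lemma k_pos: "1 \<le> k"
  using multi_cover unfolding is_multi_cover_def by blast

lemma C0_subset_C: "C0 \<subseteq> C"
  using k_pos cover_subset_C C0_subset_cover by (meson atLeastAtMost_iff order.refl subset_trans)

lemma co_member_subset: "h \<in> {1..k} \<Longrightarrow> co_member k Cs h \<subseteq> C - C0"
  using C0_subset_cover unfolding co_member_def by blast

lemma finite_co_member: "finite (co_member k Cs h)"
  unfolding co_member_def using finite_C by blast

section \<open>Bounds and signs of the MCI coefficients\<close>

lemma coeff_outside: "i \<notin> C \<Longrightarrow> \<alpha> i = 0"
  using MCI unfolding is_MCI_def Let_def by blast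

lemma coeff_last: "C - C0 \<noteq> {} \<Longrightarrow> \<alpha> (Max (C - C0)) = 1"
  using MCI unfolding is_MCI_def Let_def by blast

lemma coeff_bound:
  assumes "i \<in> C - C0" and "i \<noteq> Max (C - C0)"
  shows "max0 {max0 (\<alpha> ` {l \<in> co_member k Cs h. l > i}) | h. h \<in> {1..k} \<and> i \<in> Cs h} + 1 \<le> \<alpha> i"
  using MCI assms unfolding is_MCI_def Let_def by blast

text \<open>Downward induction on the index: the bound refers only to larger indices of
  \<open>C - C0\<close>, so its maxima are nonnegative (0 if empty) and the added 1 remains.\<close>

lemma coeff_pos_discrepancy: "i \<in> C - C0 \<Longrightarrow> 1 \<le> \<alpha> i"
proof (induction "n - i" arbitrary: i rule: less_induct)
  case less
  show ?case
  proof (cases "i = Max (C - C0)")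
    case True
    then show ?thesis
      using coeff_last less.prems by force
  next
    case False
    have "1 \<le> \<alpha> l" if "h \<in> {1..k}" "l \<in> co_member k Cs h" "i < l" for h l
    proof -
      have "l \<in> C - C0"
        using that co_member_subset by blast
      then show ?thesis
        using that(3) C_subset by (intro less.hyps) (auto simp: subset_iff)
    qed
    then have "0 \<le> max0 (\<alpha> ` {l \<in> co_member k Cs h. l > i})" if "h \<in> {1..k}" for h
      using that finite_co_member by (intro max0_nonneg) fastforce+
    then have "0 \<le> max0 {max0 (\<alpha> ` {l \<in> co_member k Cs h. l > i}) | h. h \<in> {1..k} \<and> i \<in> Cs h}"
      by (intro max0_nonneg) auto
    then show ?thesis
      using coeff_bound[OF less.prems False] by linarith
  qed
qed

lemma coeff_less:
  assumes "h \<in> {1..k}" and "i \<in> Cs h - C0" and "l \<in> C - Cs h" and "i < l"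
  shows "\<alpha> l < \<alpha> i"
proof -
  have l: "l \<in> co_member k Cs h"
    using assms(3) unfolding co_member_def .
  have i: "i \<in> C - C0"
    using assms(1,2) cover_subset_C by blast
  have "l \<in> C - C0"
    using assms(1) l co_member_subset by blast
  \<comment> \<open>A larger index in \<open>C - C0\<close> shows that \<open>i\<close> is not the
    last one, so the recursive bound applies to it.\<close>
  then have "l \<le> Max (C - C0)"
    using finite_C by simp
  then have "max0 {max0 (\<alpha> ` {l \<in> co_member k Cs h. l > i}) | h. h \<in> {1..k} \<and> i \<in> Cs h} + 1 \<le> \<alpha> i"
    using i assms(4) by (intro coeff_bound) auto
  moreover have "max0 (\<alpha> ` {l \<in> co_member k Cs h. l > i})
      \<le> max0 {max0 (\<alpha> ` {l \<in> co_member k Cs h. l > i}) | h. h \<in> {1..k} \<and> i \<in> Cs h}"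
    using assms(1,2) by (intro max0_upper) auto
  moreover have "\<alpha> l \<le> max0 (\<alpha> ` {l \<in> co_member k Cs h. l > i})"
    using l assms(4) finite_co_member by (intro max0_upper) auto
  ultimately show ?thesis
    by linarith
qed

text \<open>Here \<open>h\<close> attains the minimum in the bound for \<alpha> j; the two estimates
  are the two arguments of the inner maximum.\<close>

lemma coeff_C0E:
  assumes "j \<in> C0"
  obtains h where "h \<in> {1..k}" "\<And>l. l \<in> C - Cs h \<Longrightarrow> l < j \<Longrightarrow> \<alpha> l \<le> \<alpha> j"
    "sum \<alpha> {l \<in> C - Cs h. j < l} < \<alpha> j"
proof -
  let ?b = "\<lambda>h. max (max0 (\<alpha> ` {l \<in> co_member k Cs h. l < j}))
                    ((\<Sum>l\<in>{l \<in> co_member k Cs h. l > j}. \<alpha> l) + 1)"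
  have "Min {?b h | h. h \<in> {1..k}} \<in> {?b h | h. h \<in> {1..k}}"
    using k_pos by (intro Min_in) auto
  then obtain h where h: "h \<in> {1..k}" "Min {?b h | h. h \<in> {1..k}} = ?b h"
    by blast
  have "Min {?b h | h. h \<in> {1..k}} \<le> \<alpha> j"
    using MCI assms unfolding is_MCI_def Let_def by blast
  then have le: "max0 (\<alpha> ` {l \<in> co_member k Cs h. l < j}) \<le> \<alpha> j"
    "sum \<alpha> {l \<in> co_member k Cs h. l > j} < \<alpha> j"
    unfolding h(2) by auto
  show ?thesis
  proof
    show "h \<in> {1..k}" by (fact h(1))
    show "\<alpha> l \<le> \<alpha> j" if "l \<in> C - Cs h" "l < j" for l
    proof -
      have "\<alpha> l \<le> max0 (\<alpha> ` {l \<in> co_member k Cs h. l < j})"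
        using that finite_co_member by (intro max0_upper) (auto simp: co_member_def)
      then show ?thesis
        using le(1) by linarith
    qed
    show "sum \<alpha> {l \<in> C - Cs h. j < l} < \<alpha> j"
      using le(2) by (simp add: co_member_def)
  qed
qed

lemma coeff_pos:
  assumes "i \<in> C"
  shows "0 < \<alpha> i"
proof (cases "i \<in> C0")
  case True
  then obtain h where h: "h \<in> {1..k}" "sum \<alpha> {l \<in> C - Cs h. i < l} < \<alpha> i"
    by (rule coeff_C0E)
  have "0 \<le> sum \<alpha> {l \<in> C - Cs h. i < l}"
    using coeff_pos_discrepancy C0_subset_cover[OF h(1)] by (intro sum_nonneg) force
  then show ?thesis
    using h(2) by linarith
next
  case False
  then show ?thesis
    using assms coeff_pos_discrepancy by force
qed

section \<open>Validity of the MCI for subsets of \<open>C\<close>\<close>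

lemma less_rhs:
  assumes "h \<in> {1..k}" and "s < sum \<alpha> (Cs h)"
  shows "s \<le> \<beta>"
proof -
  have "\<beta> = Max {\<Sum>i\<in>Cs h. \<alpha> i | h. h \<in> {1..k}} - 1"
    using MCI unfolding is_MCI_def Let_def by blast
  moreover have "sum \<alpha> (Cs h) \<le> Max {\<Sum>i\<in>Cs h. \<alpha> i | h. h \<in> {1..k}}"
    using assms(1) by (intro Max_ge) auto
  ultimately show ?thesis
    using assms(2) by linarith
qed

lemma sum_le_rhs_of_C0_subset:
  assumes "X \<subseteq> C" and "C0 \<subseteq> X" and nd: "\<And>h. h \<in> {1..k} \<Longrightarrow> \<not> X \<triangleright> Cs h"
  shows "sum \<alpha> X \<le> \<beta>"
proof -
  let ?T = "X - C0"
  have X: "X = C0 \<union> ?T"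
    using assms(2) by blast
  have Cs: "Cs h = C0 \<union> (Cs h - C0)" if "h \<in> {1..k}" for h
    using C0_subset_cover[OF that] by blast
  have "?T \<subseteq> \<Union>(discrepancy_family k Cs)"
    using assms(1) unfolding discrepancy_family_def family_union_def by blast
  \<comment> \<open>Equality would give \<open>X = Cs h\<close>, and every set dominates
    itself.\<close>
  moreover have not_eq: "?T \<noteq> Cs h - C0" if "h \<in> {1..k}" for h
    using nd[OF that] dominates_subset[of "Cs h" X] X Cs[OF that] by auto
  then have "?T \<notin> discrepancy_family k Cs"
    unfolding discrepancy_family_def by blast
  ultimately obtain h where h: "h \<in> {1..k}" "?T \<triangleright> Cs h - C0 \<or> Cs h - C0 \<triangleright> ?T"
    using multi_cover unfolding is_multi_cover_def discrepancy_family_def by blast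
  \<comment> \<open>Adding \<open>C0\<close> back on both sides would give X \<triangleright> Cs h,
    so only the other direction of the comparison survives.\<close>
  have "\<not> ?T \<triangleright> Cs h - C0"
    using dominates_Un[of ?T "Cs h - C0" C0] nd[OF h(1)] X Cs[OF h(1)] by auto
  then have dom: "Cs h - C0 \<triangleright> ?T"
    using h(2) by blast
  have finX: "finite X"
    using assms(1) finite_C finite_subset by blast
  have "sum \<alpha> ?T < sum \<alpha> (Cs h - C0)"
  proof (rule dominates_sum_less[OF _ _ dom not_eq[OF h(1)]])
    show "0 < \<alpha> i" if "i \<in> Cs h - C0" for i
      using that coeff_pos cover_subset_C[OF h(1)] by blast
    show "\<alpha> l < \<alpha> i" if "i \<in> Cs h - C0" "l \<in> ?T - (Cs h - C0)" "i < l" for i l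
      using that assms(1) by (intro coeff_less[OF h(1)]) auto
  qed (use finX finite_cover[OF h(1)] in auto)
  then have "sum \<alpha> X < sum \<alpha> (Cs h)"
    using sum.subset_diff[OF assms(2) finX, of \<alpha>]
      sum.subset_diff[OF C0_subset_cover[OF h(1)] finite_cover[OF h(1)], of \<alpha>] by linarith
  then show ?thesis
    using less_rhs h(1) by blast
qed

lemma sum_le_rhs:
  assumes "X \<subseteq> C" and "\<And>h. h \<in> {1..k} \<Longrightarrow> \<not> X \<triangleright> Cs h"
  shows "sum \<alpha> X \<le> \<beta>"
  using assms
proof (induction "card (C0 - X)" arbitrary: X rule: less_induct)
  case less
  have finX: "finite X"
    using less.prems(1) finite_C finite_subset by blast
  show ?case
  proof (cases "C0 \<subseteq> X")
    case True
    then show ?thesis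
      using less.prems sum_le_rhs_of_C0_subset by blast
  next
    case False
    then obtain j where j: "j \<in> C0" "j \<notin> X"
      by blast
    obtain h where h: "h \<in> {1..k}" and low: "\<And>l. l \<in> C - Cs h \<Longrightarrow> l < j \<Longrightarrow> \<alpha> l \<le> \<alpha> j"
      and high: "sum \<alpha> {l \<in> C - Cs h. j < l} < \<alpha> j"
      using coeff_C0E[OF j(1)] by blast
    show ?thesis
    proof (cases "\<exists>l\<in>X - Cs h. l < j")
      case True
      then obtain l where l: "l \<in> X" "l \<notin> Cs h" "l < j"
        by blast
      let ?Y = "insert j (X - {l})"
      have "X \<triangleright> ?Y"
        using l by (intro dominates_exchange) auto
      then have "\<not> ?Y \<triangleright> Cs h'" if "h' \<in> {1..k}" for h'
        using less.prems(2)[OF that] dominates_trans by blast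
      moreover have "C0 - ?Y \<subset> C0 - X"
        using j l C0_subset_cover[OF h] by blast
      then have "card (C0 - ?Y) < card (C0 - X)"
        using finite_C C0_subset_C by (meson finite_Diff finite_subset psubset_card_mono)
      ultimately have "sum \<alpha> ?Y \<le> \<beta>"
        using less.prems(1) j C0_subset_C by (intro less.hyps) auto
      moreover have "sum \<alpha> ?Y = \<alpha> j + (sum \<alpha> X - \<alpha> l)"
        using finX j(2) l(1) by (simp add: sum_diff1)
      moreover have "\<alpha> l \<le> \<alpha> j"
        using low l less.prems(1) by blast
      ultimately show ?thesis
        by linarith
    next
      case False
      have jh: "j \<in> Cs h"
        using j(1) C0_subset_cover[OF h] by blast
      have "X - Cs h \<subseteq> {l \<in> C - Cs h. j < l}"
        using False less.prems(1) jh by (force simp: not_less le_less)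
      then have "sum \<alpha> (X - Cs h) \<le> sum \<alpha> {l \<in> C - Cs h. j < l}"
        using finite_C coeff_pos by (intro sum_mono2) (auto intro: less_imp_le)
      \<comment> \<open>Relative to \<open>Cs h\<close>, the set \<open>X\<close> loses at least
        \<alpha> j, which exceeds all that \<open>X - Cs h\<close> contributes.\<close>
      moreover have "sum \<alpha> (X \<inter> Cs h) \<le> sum \<alpha> (Cs h - {j})"
        using finite_cover[OF h] j(2) coeff_pos cover_subset_C[OF h]
        by (intro sum_mono2) (auto intro: less_imp_le)
      moreover have "sum \<alpha> (Cs h - {j}) = sum \<alpha> (Cs h) - \<alpha> j"
        using finite_cover[OF h] jh by (simp add: sum_diff1)
      ultimately have "sum \<alpha> X < sum \<alpha> (Cs h)"
        using high sum.Int_Diff[OF finX, of \<alpha> "Cs h"] by linarith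
      then show ?thesis
        using less_rhs h by blast
    qed
  qed
qed

section \<open>Validity of the extended inequality\<close>

definition ext_weight :: "nat \<Rightarrow> int" where
  "ext_weight i = (if i \<in> C then \<alpha> i else extended_coeff k Cs \<alpha> i)"

text \<open>Induction on the number of elements outside \<open>C\<close>. A single weight on all
  indices lets exchanges cross the boundary of \<open>C\<close>.\<close>

lemma sum_ext_weight_le_rhs:
  assumes "finite X" and "\<And>h. h \<in> {1..k} \<Longrightarrow> \<not> X \<triangleright> Cs h"
  shows "sum ext_weight X \<le> \<beta>"
  using assms
proof (induction "card (X - C)" arbitrary: X rule: less_induct)
  case less
  show ?case
  proof (cases "X \<subseteq> C")
    case True
    then have "sum ext_weight X = sum \<alpha> X"
      by (intro sum.cong) (auto simp: ext_weight_def)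
    then show ?thesis
      using sum_le_rhs[OF True less.prems(2)] by simp
  next
    case False
    then obtain i where i: "i \<in> X" "i \<notin> C"
      by blast
    have step: "sum ext_weight Y \<le> \<beta>" if "X \<triangleright> Y" "finite Y" "Y - C \<subseteq> X - C - {i}" for Y
    proof (rule less.hyps)
      have "Y - C \<subset> X - C"
        using that(3) i by blast
      then show "card (Y - C) < card (X - C)"
        using less.prems(1) by (simp add: psubset_card_mono)
      show "\<not> Y \<triangleright> Cs h" if "h \<in> {1..k}" for h
        using less.prems(2)[OF that] \<open>X \<triangleright> Y\<close> dominates_trans by blast
    qed (fact that(2))
    have remove: "sum ext_weight (X - {i}) = sum ext_weight X - extended_coeff k Cs \<alpha> i"
      using less.prems(1) i by (simp add: sum_diff1 ext_weight_def)
    show ?thesis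
    proof (cases "0 < extended_coeff k Cs \<alpha> i")
      \<comment> \<open>An element of nonpositive weight can simply be dropped.\<close>
      case False
      have "sum ext_weight (X - {i}) \<le> \<beta>"
        using less.prems(1) by (intro step dominates_subset) auto
      then show ?thesis
        using remove False by linarith
    next
      case True
      let ?S = "{second_least \<alpha> (Cs h) | h. h \<in> {1..k} \<and> i < Min (Cs h)}"
      \<comment> \<open>Positivity rules out the default value of \<open>max0\<close>, so the
        maximum is attained by some cover.\<close>
      have "extended_coeff k Cs \<alpha> i \<in> ?S"
        using True unfolding extended_coeff_def by (intro max0_posE) auto
      then obtain h where h: "h \<in> {1..k}" "i < Min (Cs h)"
        and coeff: "extended_coeff k Cs \<alpha> i = second_least \<alpha> (Cs h)"
        by blast
      have ne: "Cs h \<noteq> {}"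
        using cover_nonempty[OF TOMKS cover[OF h(1)]] .
      have below: "i < m" if "m \<in> Cs h" for m
        using that h(2) finite_cover[OF h(1)] by (meson Min_le less_le_trans)
      obtain m0 where m0: "m0 \<in> Cs h"
        and least: "\<And>m. m \<in> Cs h \<Longrightarrow> m \<noteq> m0 \<Longrightarrow> second_least \<alpha> (Cs h) \<le> \<alpha> m"
        using second_least_le[OF finite_cover[OF h(1)] ne, of \<alpha>] by blast
      \<comment> \<open>Since \<open>i\<close> precedes all of \<open>Cs h\<close>, it could stand
        in for \<open>m0\<close>. This yields a missing element other than \<open>m0\<close>, whose
        weight is at least the second least.\<close>
      have "\<not> Cs h \<subseteq> insert m0 (X - {i})"
      proof
        assume "Cs h \<subseteq> insert m0 (X - {i})"
        then have "insert m0 (X - {i}) \<triangleright> Cs h"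
          by (rule dominates_subset)
        moreover have "X \<triangleright> insert m0 (X - {i})"
          using i(1) below[OF m0] by (intro dominates_exchange) auto
        ultimately show False
          using less.prems(2)[OF h(1)] dominates_trans by blast
      qed
      then obtain m where m: "m \<in> Cs h" "m \<noteq> m0" "m \<notin> X"
        using i(2) cover_subset_C[OF h(1)] by blast
      have mC: "m \<in> C"
        using m(1) cover_subset_C[OF h(1)] by blast
      have "X \<triangleright> insert m (X - {i})"
        using i(1) below[OF m(1)] by (intro dominates_exchange) auto
      then have "sum ext_weight (insert m (X - {i})) \<le> \<beta>"
        using less.prems(1) mC by (intro step) auto
      moreover have "sum ext_weight (insert m (X - {i})) = \<alpha> m + sum ext_weight (X - {i})"
        using less.prems(1) m(3) mC by (simp add: ext_weight_def)
      ultimately show ?thesis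
        using remove least[OF m(1,2)] coeff by linarith
    qed
  qed
qed

lemma extended_valid:
  assumes "x \<in> K"
  shows "(\<Sum>i\<in>{1..n} - C. extended_coeff k Cs \<alpha> i * x i) + (\<Sum>i\<in>{1..n}. \<alpha> i * x i) \<le> \<beta>"
proof -
  let ?X = "{i \<in> {1..n}. x i = 1}"
  have x01: "x i = 0 \<or> x i = 1" if "i \<in> {1..n}" for i
    using TOMKS assms that unfolding is_TOMKS_def knapsack_set_def by auto
  \<comment> \<open>Since \<alpha> vanishes outside \<open>C\<close>, the two sums have disjoint
    supports and merge into one sum of \<open>ext_weight\<close>, evaluated on the support of
    \<open>x\<close>.\<close>
  have "(\<Sum>i\<in>{1..n}. \<alpha> i * x i) = (\<Sum>i\<in>C. \<alpha> i * x i)"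
    using C_subset coeff_outside by (intro sum.mono_neutral_right) auto
  also have "\<dots> = (\<Sum>i\<in>C. ext_weight i * x i)"
    by (intro sum.cong) (auto simp: ext_weight_def)
  finally have 1: "(\<Sum>i\<in>{1..n}. \<alpha> i * x i) = (\<Sum>i\<in>C. ext_weight i * x i)" .
  have 2: "(\<Sum>i\<in>{1..n} - C. extended_coeff k Cs \<alpha> i * x i) = (\<Sum>i\<in>{1..n} - C. ext_weight i * x i)"
    by (intro sum.cong) (auto simp: ext_weight_def)
  have "(\<Sum>i\<in>{1..n} - C. ext_weight i * x i) + (\<Sum>i\<in>C. ext_weight i * x i)
      = (\<Sum>i\<in>{1..n}. ext_weight i * x i)"
    using C_subset by (intro sum.subset_diff[symmetric]) auto
  also have "\<dots> = (\<Sum>i\<in>?X. ext_weight i * x i)"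
    using x01 by (intro sum.mono_neutral_right) fastforce+
  also have "\<dots> = sum ext_weight ?X"
    by (intro sum.cong) auto
  also have "\<dots> \<le> \<beta>"
    using knapsack_support_not_dominates_cover[OF TOMKS assms cover]
    by (intro sum_ext_weight_le_rhs) auto
  finally show ?thesis
    unfolding 1 2 .
qed

end

theorem theorem2:
  fixes n k :: nat and K :: "(nat \<Rightarrow> int) set" and Cs :: "nat \<Rightarrow> nat set"
    and \<alpha> :: "nat \<Rightarrow> int" and \<beta> :: int
  assumes "is_TOMKS n K"
    and "is_multi_cover n K k Cs"
    and "is_MCI k Cs \<alpha> \<beta>"
  shows "\<forall>x\<in>K. (\<Sum>i\<in>{1..n} - family_union k Cs. extended_coeff k Cs \<alpha> i * x i)
                + (\<Sum>i\<in>{1..n}. \<alpha> i * x i) \<le> \<beta>"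
proof -
  interpret multi_cover_inequality n k K Cs \<alpha> \<beta>
    using assms by unfold_locales
  show ?thesis
    using extended_valid by blast
qed

end
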